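(* Let $\mathcal{H}$ be a Hilbert space, let $T\in L(\mathcal{H})$ be a product of two orthogonal projections, and let $\mathfrak{X}_T$ be the set of all pairs $(P,Q)$ of orthogonal projections in $L(\mathcal{H})$ with $T=PQ$. If $R(T)$ is not closed, then $\|P-Q\|=1$ for all $(P,Q)\in\mathfrak{X}_T$. If $R(T)$ is closed, then $\|P_{R(T)}-P_{N(T)^\perp}\|<1$, and $\|P-Q\|=1$ for every other $(P,Q)\in\mathfrak{X}_T$ (i.e. for every $(P,Q)\in\mathfrak{X}_T$ with $(P,Q)\neq(P_{R(T)},P_{N(T)^\perp})$).
   Context: $L(\mathcal{H})$ is the algebra of bounded linear operators on $\mathcal{H}$; $R(T)$ and $N(T)$ denote range and nullspace. $P_{\mathcal{M}}$ is the orthogonal projection onto the closed subspace $\mathcal{M}$. It is a known fact (Crimmins) that $T=P_{\overline{R(T)}}P_{N(T)^\perp}$ whenever $T$ is a product of two orthogonal projections. *)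

theory Defs
  imports "HOL-Analysis.Analysis"
begin

text \<open>
  Hilbert spaces over the reals and over the complex numbers are treated uniformly.  By the
  Gelfand--Mazur theorem a type of class \<open>real_normed_field\<close> is isometrically isomorphic to
  the reals or to the complex numbers, and the conjugation is definable from the norm because
  \<open>z * scalar_conj z = \<bar>z\<bar>\<^sup>2\<close>.
\<close>

definition scalar_conj :: "'k::real_normed_field \<Rightarrow> 'k"
  where "scalar_conj z = of_real ((norm z)\<^sup>2) / z"

lemma scalar_conj_real: "scalar_conj (x::real) = x"
  by (simp add: scalar_conj_def power2_eq_square)

lemma scalar_conj_complex: "scalar_conj z = cnj z"
  by (cases "z = 0") (simp_all add: scalar_conj_def complex_norm_square del: of_real_power)

text \<open>
  The class constraint on \<open>'h\<close> provides the norm, its completeness and the underlying real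
  Hilbert space; the axioms force \<open>inner x y\<close> to be the real part of \<open>ip x y\<close>, so every real
  or complex Hilbert space is of this form.  The inner product is linear in its first argument.
\<close>

locale hilbert_space = vector_space smul
  for smul :: "'k::real_normed_field \<Rightarrow> 'h::{real_inner,complete_space} \<Rightarrow> 'h" +
  fixes ip :: "'h \<Rightarrow> 'h \<Rightarrow> 'k"
  assumes scale_of_real: "smul (of_real r) x = r *\<^sub>R x"
    and ip_add_left: "ip (x + y) z = ip x z + ip y z"
    and ip_scale_left: "ip (smul c x) y = c * ip x y"
    and ip_commute: "ip y x = scalar_conj (ip x y)"
    and ip_self: "ip x x = of_real ((norm x)\<^sup>2)"

lemma hilbert_space_real:
  "hilbert_space (*\<^sub>R) (inner :: 'h::{real_inner,complete_space} \<Rightarrow> 'h \<Rightarrow> real)"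
  by unfold_locales
    (auto simp: scalar_conj_real algebra_simps inner_commute power2_norm_eq_inner)

lemma hilbert_space_complex: "hilbert_space (*) (\<lambda>x y. x * cnj y)"
  by unfold_locales
    (auto simp: scalar_conj_complex algebra_simps scaleR_conv_of_real complex_norm_square simp del: of_real_power)

text \<open>
  An element of \<open>'h \<Rightarrow>\<^sub>L 'h\<close> is only linear over the reals, hence the homogeneity condition.
  The norm of that type is the operator norm.
\<close>

definition bounded_operators ::
    "('k::real_normed_field \<Rightarrow> 'h::{real_inner,complete_space} \<Rightarrow> 'h) \<Rightarrow> ('h \<Rightarrow>\<^sub>L 'h) set"
  where "bounded_operators smul = {A. \<forall>c x. blinfun_apply A (smul c x) = smul c (blinfun_apply A x)}"

definition orthogonal_projection ::
    "('k::real_normed_field \<Rightarrow> 'h::{real_inner,complete_space} \<Rightarrow> 'h) \<Rightarrow> ('h \<Rightarrow> 'h \<Rightarrow> 'k)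
      \<Rightarrow> ('h \<Rightarrow>\<^sub>L 'h) \<Rightarrow> bool"
  where "orthogonal_projection smul ip P \<longleftrightarrow>
    P \<in> bounded_operators smul \<and> P o\<^sub>L P = P \<and>
    (\<forall>x y. ip (blinfun_apply P x) y = ip x (blinfun_apply P y))"

text \<open>The following is meaningful for closed subspaces \<open>M\<close> only.\<close>

definition proj_onto ::
    "('k::real_normed_field \<Rightarrow> 'h::{real_inner,complete_space} \<Rightarrow> 'h) \<Rightarrow> ('h \<Rightarrow> 'h \<Rightarrow> 'k)
      \<Rightarrow> 'h set \<Rightarrow> ('h \<Rightarrow>\<^sub>L 'h)"
  where "proj_onto smul ip M =
    (THE P. orthogonal_projection smul ip P \<and> range (blinfun_apply P) = M)"

definition nullspace :: "('h::real_normed_vector \<Rightarrow>\<^sub>L 'h) \<Rightarrow> 'h set"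
  where "nullspace A = {x. blinfun_apply A x = 0}"

definition ortho_compl :: "('h \<Rightarrow> 'h \<Rightarrow> 'k::zero) \<Rightarrow> 'h set \<Rightarrow> 'h set"
  where "ortho_compl ip S = {x. \<forall>y\<in>S. ip x y = 0}"

definition proj_factorizations ::
    "('k::real_normed_field \<Rightarrow> 'h::{real_inner,complete_space} \<Rightarrow> 'h) \<Rightarrow> ('h \<Rightarrow> 'h \<Rightarrow> 'k)
      \<Rightarrow> ('h \<Rightarrow>\<^sub>L 'h) \<Rightarrow> (('h \<Rightarrow>\<^sub>L 'h) \<times> ('h \<Rightarrow>\<^sub>L 'h)) set"
  where "proj_factorizations smul ip T =
    {(P, Q). orthogonal_projection smul ip P \<and> orthogonal_projection smul ip Q \<and> T = P o\<^sub>L Q}"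

end

theory Submission
  imports Defs
begin

text \<open>
  Pythagoras gives \<open>norm (P - Q) \<le> 1\<close> for all orthogonal projections.  If the norm is below 1, then
  \<open>1 - P (P - Q)\<close> is invertible, so \<open>P Q\<close> has the range of \<open>P\<close>, and \<open>P - Q\<close> is strictly
  contractive on \<open>R(Q)\<close>, so \<open>P Q\<close> has the nullspace of \<open>Q\<close>.  Hence \<open>R(T)\<close> is closed and \<open>P\<close>, \<open>Q\<close>
  are the canonical factors.

  Conversely let \<open>T = P Q\<close> with \<open>R(T) = R(P)\<close> and \<open>N(T) = N(Q)\<close>.  Uniform boundedness
  shows that \<open>Q\<close> is bounded below on \<open>R(P)\<close>, by \<open>\<gamma>\<close> say.  Then \<open>P Q P\<close> is onto \<open>R(P)\<close>, since
  \<open>P (1 - Q) P\<close> is a strict contraction, and by duality \<open>P\<close> is bounded below by \<open>\<gamma>\<close> on \<open>R(Q)\<close>.  By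
  Pythagoras \<open>norm (P - Q) \<le> sqrt (1 - \<gamma>\<^sup>2) < 1\<close>.
\<close>

section \<open>Minimization, Baire category and fixed-point tools in Hilbert spaces\<close>

text \<open>The point of \<open>M\<close> nearest to \<open>x\<close> works: a minimizing sequence
  is Cauchy by the parallelogram law, and minimality along each line through its limit forces
  orthogonality.\<close>

lemma orthogonal_decomposition:
  fixes M :: "'a::{real_inner,complete_space} set"
  assumes "closed M" and "subspace M"
  obtains y where "y \<in> M" and "\<And>z. z \<in> M \<Longrightarrow> inner (x - y) z = 0"
proof -
  define D where "D = (INF y\<in>M. (norm (x - y))\<^sup>2)"
  have M0: "0 \<in> M" using assms(2) by (rule subspace_0)
  have bdd: "bdd_below ((\<lambda>y. (norm (x - y))\<^sup>2) ` M)"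
    by (rule bdd_belowI2[of _ 0]) simp
  have D_le: "D \<le> (norm (x - y))\<^sup>2" if "y \<in> M" for y
    unfolding D_def using bdd that by (rule cINF_lower)
  have "\<exists>y\<in>M. (norm (x - y))\<^sup>2 < D + e" if "e > 0" for e
    using cINF_less_iff[OF _ bdd, of "D + e"] M0 that unfolding D_def by auto
  then have "\<forall>n. \<exists>y. y \<in> M \<and> (norm (x - y))\<^sup>2 < D + 1 / Suc n"
    by (metis of_nat_0_less_iff zero_less_Suc zero_less_divide_1_iff)
  then obtain s where sM: "\<And>n. s n \<in> M" and s: "\<And>n. (norm (x - s n))\<^sup>2 < D + 1 / Suc n"
    by metis
  have close: "(norm (s m - s n))\<^sup>2 < 2 * (1 / Suc m) + 2 * (1 / Suc n)" for m n
  proof -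
    have "(1/2) *\<^sub>R (s m + s n) \<in> M"
      using assms(2) sM by (intro subspace_scale subspace_add)
    then have "D \<le> (norm (x - (1/2) *\<^sub>R (s m + s n)))\<^sup>2" by (rule D_le)
    \<comment> \<open>Parallelogram law for \<open>x - s m\<close> and \<open>x - s n\<close>, whose
      average is \<open>x\<close> minus a midpoint in \<open>M\<close>.\<close>
    moreover have "(norm (s m - s n))\<^sup>2 = 2 * (norm (x - s m))\<^sup>2 + 2 * (norm (x - s n))\<^sup>2
        - 4 * (norm (x - (1/2) *\<^sub>R (s m + s n)))\<^sup>2"
      by (simp add: power2_norm_eq_inner inner_simps inner_commute algebra_simps)
    ultimately show ?thesis using s[of m] s[of n] by linarith
  qed
  have "Cauchy s"
  proof (rule metric_CauchyI)
    fix e :: real assume "e > 0"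
    then obtain N where N: "inverse (real (Suc N)) < e\<^sup>2 / 4"
      using reals_Archimedean[of "e\<^sup>2 / 4"] by auto
    have "dist (s m) (s n) < e" if "m \<ge> N" "n \<ge> N" for m n
    proof -
      have "1 / real (Suc m) \<le> inverse (real (Suc N))" "1 / real (Suc n) \<le> inverse (real (Suc N))"
        using that by (simp_all add: field_simps)
      then have "(norm (s m - s n))\<^sup>2 < e\<^sup>2" using close[of m n] N by linarith
      then show ?thesis using \<open>e > 0\<close> by (simp add: dist_norm power2_less_imp_less)
    qed
    then show "\<exists>N. \<forall>m\<ge>N. \<forall>n\<ge>N. dist (s m) (s n) < e" by blast
  qed
  then obtain y where y: "s \<longlonglongrightarrow> y" using Cauchy_convergent convergent_def by blast
  have yM: "y \<in> M" using assms(1) sM y by (metis closed_sequentially)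
  have lim: "(\<lambda>n. (norm (x - s n))\<^sup>2) \<longlonglongrightarrow> (norm (x - y))\<^sup>2" by (intro tendsto_intros y)
  have "(\<lambda>n. D + 1 / Suc n) \<longlonglongrightarrow> D"
    using LIMSEQ_inverse_real_of_nat_add[of D] by (simp add: inverse_eq_divide)
  with lim have y_le: "(norm (x - y))\<^sup>2 \<le> D"
    by (rule LIMSEQ_le) (use s in \<open>auto intro: less_imp_le\<close>)
  have "inner (x - y) z = 0" if "z \<in> M" for z
  proof (cases "z = 0")
    case False
    \<comment> \<open>This \<open>t\<close> minimizes the quadratic expanding
      \<open>(norm (x - (y + t *\<^sub>R z)))\<^sup>2\<close>.\<close>
    define t where "t = inner (x - y) z / (norm z)\<^sup>2"
    have "y + t *\<^sub>R z \<in> M" using assms(2) yM that by (intro subspace_add subspace_scale)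
    then have "(norm (x - y))\<^sup>2 \<le> (norm (x - (y + t *\<^sub>R z)))\<^sup>2"
      using D_le y_le by (meson order_trans)
    also have "\<dots> = (norm (x - y))\<^sup>2 - 2 * t * inner (x - y) z + t * t * (norm z)\<^sup>2"
      by (simp add: power2_norm_eq_inner inner_simps inner_commute algebra_simps)
    also have "\<dots> = (norm (x - y))\<^sup>2 - (inner (x - y) z)\<^sup>2 / (norm z)\<^sup>2"
      using False by (simp add: t_def power2_eq_square)
    finally have "(inner (x - y) z)\<^sup>2 / (norm z)\<^sup>2 \<le> 0" by simp
    then show ?thesis using False by (simp add: divide_le_0_iff)
  qed simp
  with yM show thesis by (rule that)
qed

text \<open>Baire category, applied to the sublevel sets of \<open>x \<mapsto> sup {\<bar>inner z x\<bar> | z \<in> S}\<close>.\<close>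

lemma weakly_bounded_imp_bounded:
  fixes S :: "'a::{real_inner,complete_space} set"
  assumes "\<And>x. bounded ((\<lambda>z. inner z x) ` S)"
  shows "bounded S"
proof -
  define F where "F n = {x. \<forall>z\<in>S. \<bar>inner z x\<bar> \<le> real n}" for n
  have "F n = (\<Inter>z\<in>S. {x. \<bar>inner z x\<bar> \<le> real n})" for n by (auto simp: F_def)
  then have F_closed: "closed (F n)" for n
    by (simp only:) (intro closed_INT ballI closed_Collect_le continuous_intros)
  have "(\<Union>n. F n) = UNIV"
  proof (intro equalityI subset_UNIV subsetI)
    fix x
    obtain B where B: "\<And>z. z \<in> S \<Longrightarrow> \<bar>inner z x\<bar> \<le> B"
      using assms[of x] by (auto simp: bounded_iff)
    obtain n where "B \<le> real n" using real_arch_simple by blast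
    then have "x \<in> F n" using B by (fastforce simp: F_def)
    then show "x \<in> (\<Union>n. F n)" by blast
  qed
  have "\<exists>n. interior (F n) \<noteq> {}"
  proof (rule ccontr)
    assume "\<not> ?thesis"
    then have "interior (\<Union>n. F n) = {}"
      using Met_TC.metric_Baire_category_alt[of "range F"] F_closed complete_UNIV[where 'a='a] by auto
    then show False using \<open>(\<Union>n. F n) = UNIV\<close> by simp
  qed
  then obtain n where "interior (F n) \<noteq> {}" by blast
  then obtain a r where r: "r > 0" "cball a r \<subseteq> F n"
    by (metis equals0I mem_interior_cball)
  have "norm z \<le> 2 * real n / r" if "z \<in> S" for z
  proof -
    \<comment> \<open>Both points lie in the ball inside \<open>F n\<close>; combining the bounds
      there isolates \<open>r * inner z (sgn z) = r * norm z\<close>.\<close>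
    have "a \<in> F n" "a + r *\<^sub>R sgn z \<in> F n"
      using r by (auto simp: dist_norm norm_sgn subset_iff)
    then have "\<bar>inner z a\<bar> \<le> real n" "\<bar>inner z (a + r *\<^sub>R sgn z)\<bar> \<le> real n"
      using that by (auto simp: F_def)
    then have "r * inner z (sgn z) \<le> 2 * real n" by (simp add: inner_simps)
    moreover have "inner z (sgn z) = norm z"
      by (cases "z = 0") (simp_all add: sgn_div_norm power2_norm_eq_inner[symmetric] power2_eq_square)
    ultimately show ?thesis using r by (simp add: field_simps)
  qed
  then show ?thesis by (auto simp: bounded_iff)
qed

text \<open>A solution is a fixed point of the contraction
  \<open>\<lambda>y. x + B y\<close>.\<close>

lemma surj_id_minus_contraction:
  fixes B :: "'a::{real_normed_vector,complete_space} \<Rightarrow>\<^sub>L 'a"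
  assumes "norm B < 1"
  obtains y where "y - B y = x"
proof -
  have "dist (x + B u) (x + B v) \<le> norm B * dist u v" for u v
    using norm_blinfun[of B "u - v"] by (simp add: dist_norm blinfun.diff_right)
  then obtain y where "x + B y = y"
    using banach_fix_type[of "norm B" "\<lambda>y. x + B y"] assms by auto
  then show thesis using that by (metis add_diff_cancel_right')
qed

subsection \<open>Pairs of projections in a real Hilbert space\<close>

abbreviation real_projection :: "('h::{real_inner,complete_space} \<Rightarrow>\<^sub>L 'h) \<Rightarrow> bool"
  where "real_projection \<equiv> orthogonal_projection (*\<^sub>R) inner"

lemma real_projectionI:
  fixes P :: "'h::{real_inner,complete_space} \<Rightarrow>\<^sub>L 'h"
  assumes "\<And>x. P (P x) = P x" and "\<And>x y. inner (P x) y = inner x (P y)"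
  shows "real_projection P"
  using assms
  by (auto simp: orthogonal_projection_def bounded_operators_def blinfun.scaleR_right intro: blinfun_eqI)

lemma real_projection_idem:
  assumes "real_projection P"
  shows "P (P x) = P x"
  using assms unfolding orthogonal_projection_def by (metis blinfun_apply_blinfun_compose)

lemma real_projection_sym:
  assumes "real_projection P"
  shows "inner (P x) y = inner x (P y)"
  using assms unfolding orthogonal_projection_def by blast

lemma norm_sq_real_projection:
  assumes "real_projection P"
  shows "(norm x)\<^sup>2 = (norm (P x))\<^sup>2 + (norm (x - P x))\<^sup>2"
proof -
  have "inner (P x) (P x) = inner x (P x)"
    using real_projection_idem[OF assms] real_projection_sym[OF assms] by metis
  then show ?thesis by (simp add: power2_norm_eq_inner inner_simps inner_commute)
qed

lemma norm_real_projection_apply_le: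
  assumes "real_projection P"
  shows "norm (P x) \<le> norm x" and "norm (x - P x) \<le> norm x"
  using norm_sq_real_projection[OF assms, of x]
  by (auto intro: power2_le_imp_le)

lemma closed_range_real_projection:
  assumes "real_projection P"
  shows "closed (range P)"
proof -
  have "range P = {x. P x = x}"
    using real_projection_idem[OF assms] by (auto intro: range_eqI[OF sym])
  then show ?thesis by (simp add: closed_Collect_eq continuous_intros)
qed

section \<open>Norm estimates for the difference of two projections\<close>

text \<open>With \<open>u = x - Q x\<close>, the vector \<open>(P - Q) x\<close> is
  \<open>P u\<close> minus \<open>Q x - P (Q x)\<close>, which are orthogonal. Their norms are at
  most \<open>s * norm u\<close> and \<open>s * norm (Q x)\<close>, and Pythagoras for
  \<open>x = u + Q x\<close> finishes.\<close>

lemma norm_diff_real_projections_le: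
  assumes P: "real_projection P" and Q: "real_projection Q"
    and s: "0 \<le> s" "\<And>x. norm (Q x - P (Q x)) \<le> s * norm (Q x)" "\<And>x. norm (P x - Q (P x)) \<le> s * norm (P x)"
  shows "norm (P - Q) \<le> s"
proof (rule norm_blinfun_bound[OF s(1)])
  fix x
  define u where "u = x - Q x"
  have Qu: "Q u = 0" by (simp add: u_def blinfun.diff_right real_projection_idem[OF Q])
  \<comment> \<open>The bound on \<open>P x - Q (P x)\<close> passes to the adjoint by pairing
    \<open>P u\<close> with \<open>u\<close> and cancelling one factor
    \<open>norm (P u)\<close>.\<close>
  have "(norm (P u))\<^sup>2 = inner (P u) u"
    by (metis P power2_norm_eq_inner real_projection_idem real_projection_sym)
  also have "\<dots> = inner (P u - Q (P u)) u"
    using real_projection_sym[OF Q, of "P u" u] by (simp add: inner_diff_left Qu)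
  also have "\<dots> \<le> s * norm (P u) * norm u"
    using norm_cauchy_schwarz[of "P u - Q (P u)" u] mult_right_mono[OF s(3)[of u], of "norm u"] by simp
  finally have Pu: "norm (P u) \<le> s * norm u"
    using s(1) by (cases "norm (P u) = 0") (auto simp: power2_eq_square mult.assoc mult.left_commute)
  have "inner (P u) (Q x - P (Q x)) = 0"
    using real_projection_sym[OF P, of u] real_projection_idem[OF P] by (simp add: blinfun.diff_right)
  moreover have "(P - Q) x = P u - (Q x - P (Q x))"
    by (simp add: u_def blinfun.diff_left blinfun.diff_right)
  ultimately have "(norm ((P - Q) x))\<^sup>2 = (norm (P u))\<^sup>2 + (norm (Q x - P (Q x)))\<^sup>2"
    by (simp add: power2_norm_eq_inner inner_diff_left inner_diff_right inner_commute)
  also have "\<dots> \<le> (s * norm u)\<^sup>2 + (s * norm (Q x))\<^sup>2"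
    by (intro add_mono power_mono Pu s(2)) auto
  also have "\<dots> = (s * norm x)\<^sup>2"
    using norm_sq_real_projection[OF Q, of x] by (simp add: u_def power_mult_distrib algebra_simps)
  finally show "norm ((P - Q) x) \<le> s * norm x" by (rule power2_le_imp_le) (simp add: s(1))
qed

lemma norm_diff_real_projections_le_1:
  assumes "real_projection P" and "real_projection Q"
  shows "norm (P - Q) \<le> 1"
  by (rule norm_diff_real_projections_le) (simp_all add: assms norm_real_projection_apply_le)

lemma range_nullspace_of_norm_diff_less_1:
  assumes P: "real_projection P" and Q: "real_projection Q" and less: "norm (P - Q) < 1"
  shows "range (P o\<^sub>L Q) = range P" and "nullspace (P o\<^sub>L Q) = nullspace Q"
proof -
  have "norm P \<le> 1" by (rule norm_blinfun_bound) (simp_all add: norm_real_projection_apply_le[OF P])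
  then have "norm (P o\<^sub>L (P - Q)) < 1"
    using less norm_blinfun_compose[of P "P - Q"] mult_right_mono[of "norm P" 1 "norm (P - Q)"] by simp
  have "P x \<in> range (P o\<^sub>L Q)" for x
  proof -
    obtain y where "y - (P o\<^sub>L (P - Q)) y = P x"
      using \<open>norm (P o\<^sub>L (P - Q)) < 1\<close> by (rule surj_id_minus_contraction)
    \<comment> \<open>Applying \<open>P\<close> cancels both copies of \<open>P y\<close> by
      idempotence and leaves \<open>P (Q y)\<close>.\<close>
    then have "P (y - P (P y - Q y)) = P (P x)" by (simp add: blinfun.diff_left)
    then have "P x = P (Q y)" by (simp add: blinfun.diff_right real_projection_idem[OF P])
    then show ?thesis by simp
  qed
  then show "range (P o\<^sub>L Q) = range P" by auto
  have "Q x = 0" if "P (Q x) = 0" for x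
  proof (rule ccontr)
    assume "Q x \<noteq> 0"
    \<comment> \<open>As \<open>P (Q x) = 0\<close>, the operator \<open>P - Q\<close> maps
      \<open>Q x\<close> to its negative and does not shrink it.\<close>
    moreover have "norm (Q x) \<le> norm (P - Q) * norm (Q x)"
      using norm_blinfun[of "P - Q" "Q x"] that by (simp add: blinfun.diff_left real_projection_idem[OF Q])
    ultimately show False using less by simp
  qed
  then show "nullspace (P o\<^sub>L Q) = nullspace Q" by (auto simp: nullspace_def)
qed

text \<open>Uniform boundedness for the vectors of \<open>range P\<close> that \<open>Q\<close>
  sends into the unit ball: writing \<open>P w = P (Q x)\<close> turns \<open>inner (P y) w\<close>
  into \<open>inner (Q (P y)) x\<close>, which is at most \<open>norm x\<close> in absolute
  value.\<close>

lemma bounded_below_of_range_eq: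
  assumes P: "real_projection P" and Q: "real_projection Q" and range: "range (P o\<^sub>L Q) = range P"
  obtains \<gamma> where "0 < \<gamma>" and "\<gamma> \<le> 1" and "\<And>y. \<gamma> * norm (P y) \<le> norm (Q (P y))"
proof -
  define S where "S = {P y |y. norm (Q (P y)) \<le> 1}"
  have "bounded ((\<lambda>z. inner z w) ` S)" for w
  proof -
    have "P w \<in> range (P o\<^sub>L Q)" by (simp only: range rangeI)
    then obtain x where x: "P w = P (Q x)" by auto
    have "\<bar>inner (P y) w\<bar> \<le> norm x" if "norm (Q (P y)) \<le> 1" for y
    proof -
      have "inner (P y) w = inner (Q (P y)) x"
        using real_projection_sym[OF P, of "P y" w] real_projection_sym[OF P, of "P y" "Q x"]
          real_projection_sym[OF Q, of "P y" x]
        by (simp add: real_projection_idem[OF P] x)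
      then show ?thesis
        using Cauchy_Schwarz_ineq2[of "Q (P y)" x] mult_right_mono[OF that, of "norm x"] by simp
    qed
    then show ?thesis by (auto simp: S_def bounded_iff)
  qed
  then obtain b where b: "\<And>z. z \<in> S \<Longrightarrow> norm z \<le> b"
    using weakly_bounded_imp_bounded[of S] by (auto simp: bounded_iff)
  \<comment> \<open>The maximum keeps \<open>B\<close> positive and the final constant
    \<open>1 / B\<close> at most 1.\<close>
  define B where "B = max b 1"
  have B: "t * norm (P y) \<le> B" if "0 \<le> t" "t * norm (Q (P y)) \<le> 1" for t y
  proof -
    have "P (t *\<^sub>R y) \<in> S" using that by (auto simp: S_def blinfun.scaleR_right intro!: exI[of _ "t *\<^sub>R y"])
    then show ?thesis using b[of "P (t *\<^sub>R y)"] that by (simp add: B_def blinfun.scaleR_right)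
  qed
  have "norm (P y) \<le> B * norm (Q (P y))" for y
  proof (cases "Q (P y) = 0")
    case True
    have "P y = 0"
    proof (rule ccontr)
      assume "P y \<noteq> 0"
      \<comment> \<open>If \<open>Q\<close> kills \<open>P y\<close>, then the positive multiple of
        \<open>P y\<close> with norm \<open>B + 1\<close> lies in \<open>S\<close>, against the
        bound.\<close>
      then show False using B[of "(B + 1) / norm (P y)" y] True by (simp add: B_def)
    qed
    then show ?thesis by simp
  next
    case False
    then show ?thesis using B[of "1 / norm (Q (P y))" y] by (simp add: field_simps)
  qed
  then show thesis using that[of "1 / B"] by (simp add: B_def field_simps)
qed

lemma norm_minus_projection_le:
  assumes "real_projection P" and "0 \<le> \<gamma>" and "\<gamma> \<le> 1" and "\<gamma> * norm x \<le> norm (P x)"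
  shows "norm (x - P x) \<le> sqrt (1 - \<gamma>\<^sup>2) * norm x"
proof -
  have "(\<gamma> * norm x)\<^sup>2 \<le> (norm (P x))\<^sup>2" using assms by (intro power_mono) auto
  moreover have "\<gamma>\<^sup>2 \<le> 1" using assms by (simp add: power_le_one)
  ultimately have "(norm (x - P x))\<^sup>2 \<le> (sqrt (1 - \<gamma>\<^sup>2) * norm x)\<^sup>2"
    using norm_sq_real_projection[OF assms(1), of x] by (simp add: power_mult_distrib algebra_simps)
  then show ?thesis by (rule power2_le_imp_le) (use \<open>\<gamma>\<^sup>2 \<le> 1\<close> in simp)
qed

lemma compression_surj:
  assumes P: "real_projection P" and Q: "real_projection Q"
    and \<gamma>: "0 < \<gamma>" "\<gamma> \<le> 1" "\<And>y. \<gamma> * norm (P y) \<le> norm (Q (P y))"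
  obtains y where "P (Q (P y)) = P x"
proof -
  define s where "s = sqrt (1 - \<gamma>\<^sup>2)"
  have s: "0 \<le> s" "s < 1" using \<gamma> by (auto simp: s_def power_le_one)
  \<comment> \<open>On \<open>range P\<close>, the operator \<open>id_blinfun - B\<close> acts as
    \<open>P Q P\<close>.\<close>
  define B where "B = P o\<^sub>L (id_blinfun - Q) o\<^sub>L P"
  have "norm (B y) \<le> s * norm y" for y
  proof -
    have "norm (B y) \<le> norm (P y - Q (P y))"
      using norm_real_projection_apply_le(1)[OF P] by (simp add: B_def blinfun.diff_left)
    also have "\<dots> \<le> s * norm (P y)"
      unfolding s_def using \<gamma> by (intro norm_minus_projection_le Q) auto
    also have "\<dots> \<le> s * norm y"
      using s norm_real_projection_apply_le(1)[OF P] by (simp add: mult_left_mono)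
    finally show ?thesis .
  qed
  then have "norm B \<le> s" using s by (intro norm_blinfun_bound) auto
  then have "norm B < 1" using s(2) by (rule le_less_trans)
  then obtain y where "y - B y = P x" by (rule surj_id_minus_contraction)
  then have "P (y - P (P y - Q (P y))) = P (P x)" by (simp add: B_def blinfun.diff_left)
  then have "P (Q (P y)) = P x" by (simp add: blinfun.diff_right real_projection_idem[OF P])
  then show thesis by (rule that)
qed

text \<open>Choose \<open>y\<close> with \<open>P (Q (P y)) = P (Q x)\<close>. Injectivity gives
  \<open>Q x = Q (P y)\<close>, so the square of \<open>norm (Q x)\<close> is
  \<open>inner (P (Q x)) (P y)\<close>. Cauchy-Schwarz and the bound on \<open>P y\<close> give the
  same \<open>\<gamma>\<close> for the swapped pair.\<close>

lemma bounded_below_swap: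
  assumes P: "real_projection P" and Q: "real_projection Q"
    and \<gamma>: "0 < \<gamma>" "\<gamma> \<le> 1" "\<And>y. \<gamma> * norm (P y) \<le> norm (Q (P y))"
    and inj: "\<And>x. P (Q x) = 0 \<Longrightarrow> Q x = 0"
  shows "\<gamma> * norm (Q x) \<le> norm (P (Q x))"
proof -
  obtain y where y: "P (Q (P y)) = P (Q x)" using compression_surj[OF P Q \<gamma>] by blast
  have "Q (x - P y) = 0" by (rule inj) (simp add: blinfun.diff_right y)
  then have Qx: "Q x = Q (P y)" by (simp add: blinfun.diff_right)
  have "(norm (Q x))\<^sup>2 = inner (P (Q x)) (P y)"
    unfolding Qx
    using real_projection_sym[OF Q, of "Q (P y)" "P y"] real_projection_sym[OF P, of "Q (P y)" "P y"]
    by (simp add: power2_norm_eq_inner real_projection_idem[OF P] real_projection_idem[OF Q])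
  also have "\<dots> \<le> norm (P (Q x)) * norm (P y)" by (rule norm_cauchy_schwarz)
  finally have "\<gamma> * (norm (Q x))\<^sup>2 \<le> norm (P (Q x)) * (\<gamma> * norm (P y))"
    using \<gamma>(1) by (simp add: mult.left_commute)
  also have "\<dots> \<le> norm (P (Q x)) * norm (Q x)" unfolding Qx by (intro mult_left_mono \<gamma>(3)) simp
  finally show ?thesis by (cases "norm (Q x) = 0") (auto simp: power2_eq_square mult.assoc[symmetric])
qed

lemma norm_diff_less_1_of_range_nullspace:
  assumes P: "real_projection P" and Q: "real_projection Q"
    and range: "range (P o\<^sub>L Q) = range P" and null: "nullspace (P o\<^sub>L Q) = nullspace Q"
  shows "norm (P - Q) < 1"
proof -
  obtain \<gamma> where \<gamma>: "0 < \<gamma>" "\<gamma> \<le> 1" "\<And>y. \<gamma> * norm (P y) \<le> norm (Q (P y))"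
    using bounded_below_of_range_eq[OF P Q range] by blast
  have inj: "Q x = 0" if "P (Q x) = 0" for x
    using null that by (auto simp: nullspace_def)
  have "norm (P - Q) \<le> sqrt (1 - \<gamma>\<^sup>2)"
    using \<gamma> bounded_below_swap[OF P Q \<gamma> inj]
    by (intro norm_diff_real_projections_le norm_minus_projection_le P Q) (auto simp: power_le_one)
  also have "\<dots> < 1" using \<gamma> by auto
  finally show ?thesis .
qed

subsection \<open>Reduction to the underlying real Hilbert space\<close>

text \<open>Each projection fixes the range of the other; moving them across the inner product
  reverses the products and identifies the two.\<close>

lemma real_projection_unique:
  assumes "real_projection P" and "real_projection P'" and "range P = range P'"
  shows "P = P'"
proof (rule blinfun_eqI)
  fix x
  have eq: "P (P' y) = P' y" "P' (P y) = P y" for y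
    using assms real_projection_idem[OF assms(1)] real_projection_idem[OF assms(2)]
    by (metis rangeE rangeI)+
  have "inner (P x) y = inner (P' x) y" for y
    using real_projection_sym[OF assms(2), of "P x" y] real_projection_sym[OF assms(1), of x "P' y"]
      real_projection_sym[OF assms(2), of x y]
    by (simp add: eq)
  then show "P x = P' x" using vector_eq_rdot by blast
qed

context hilbert_space
begin

lemma scalar_conj_mult: "c * scalar_conj c = of_real ((norm c)\<^sup>2)" for c :: 'k
  by (cases "c = 0") (auto simp: scalar_conj_def)

lemma scalar_conj_of_real: "scalar_conj (of_real r :: 'k) = of_real r"
  by (cases "r = 0") (auto simp: scalar_conj_def power2_eq_square)

text \<open>The type class gives homogeneity for real scalars only; for scalars in \<open>'k\<close>
  it comes from \<open>ip (smul c x) (smul c x)\<close>.\<close>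

lemma norm_smul: "norm (smul c x) = norm c * norm x"
proof -
  have "ip x (smul c x) = scalar_conj (c * of_real ((norm x)\<^sup>2))"
    by (simp only: ip_commute[of x "smul c x"] ip_scale_left ip_self)
  also have "\<dots> = scalar_conj c * of_real ((norm x)\<^sup>2)"
    by (cases "x = 0") (auto simp: scalar_conj_def norm_mult norm_power power2_eq_square)
  finally have "ip (smul c x) (smul c x) = (c * scalar_conj c) * of_real ((norm x)\<^sup>2)"
    by (simp add: ip_scale_left)
  then have "(of_real ((norm (smul c x))\<^sup>2) :: 'k) = of_real ((norm c * norm x)\<^sup>2)"
    by (simp only: ip_self scalar_conj_mult of_real_mult power_mult_distrib)
  then have "(norm (smul c x))\<^sup>2 = (norm c * norm x)\<^sup>2" by (simp only: of_real_eq_iff)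
  then show ?thesis by simp
qed

text \<open>A unit vector \<open>e\<close> embeds the scalars isometrically into a real inner product space.  For a
  scalar \<open>b\<close> orthogonal to the reals, multiplicativity of the norm and the parallelogram law applied
  to \<open>b\<^sup>2\<close> and \<open>(norm b)\<^sup>2\<close> force \<open>b\<^sup>2 = - (norm b)\<^sup>2\<close>.  This avoids the Gelfand--Mazur theorem.\<close>

lemma scalar_conj_eq:
  assumes "norm e = 1"
  shows "scalar_conj a = of_real (2 * inner (smul a e) e) - a"
proof -
  have norm_e: "norm (smul c e) = norm c" for c by (simp add: norm_smul assms)
  have ee: "inner e e = 1" using assms by (simp add: norm_eq_1)
  define t where "t = inner (smul a e) e"
  define b where "b = a - of_real t"
  have Jb: "smul b e = smul a e - t *\<^sub>R e" by (simp add: b_def scale_left_diff_distrib scale_of_real)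
  have b0: "inner (smul b e) e = 0" by (simp add: Jb inner_diff_left ee t_def)
  have norm_b: "(norm (b + of_real r))\<^sup>2 = (norm b)\<^sup>2 + r\<^sup>2" for r
  proof -
    have "(norm (b + of_real r))\<^sup>2 = (norm (smul b e + r *\<^sub>R e))\<^sup>2"
      by (metis norm_e scale_left_distrib scale_of_real)
    also have "\<dots> = (norm (smul b e))\<^sup>2 + r\<^sup>2"
      by (simp only: power2_norm_eq_inner inner_add_left inner_add_right inner_commute[of e "smul b e"]
          inner_scaleR_left inner_scaleR_right b0 ee) (simp add: power2_eq_square)
    finally show ?thesis by (simp add: norm_e)
  qed
  have parallelogram: "(norm (u + v))\<^sup>2 + (norm (u - v))\<^sup>2 = 2 * (norm u)\<^sup>2 + 2 * (norm v)\<^sup>2"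
    for u v :: 'k
  proof -
    have "(norm (u + v))\<^sup>2 + (norm (u - v))\<^sup>2
        = (norm (smul u e + smul v e))\<^sup>2 + (norm (smul u e - smul v e))\<^sup>2"
      by (simp only: scale_left_distrib[symmetric] scale_left_diff_distrib[symmetric] norm_e)
    also have "\<dots> = 2 * (norm (smul u e))\<^sup>2 + 2 * (norm (smul v e))\<^sup>2"
      by (simp only: power2_norm_eq_inner) (simp add: inner_simps inner_commute)
    finally show ?thesis by (simp only: norm_e)
  qed
  define n where "n = norm b"
  \<comment> \<open>Both factors have squared norm \<open>2 * n\<^sup>2\<close>. In the
    parallelogram law this uses up the whole right-hand side, so
    \<open>b * b + of_real (n * n)\<close> vanishes.\<close>
  have "norm (b * b - of_real (n * n)) = norm (b + of_real n) * norm (b + of_real (- n))"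
    by (simp add: norm_mult[symmetric] algebra_simps)
  then have "(norm (b * b - of_real (n * n)))\<^sup>2 = (2 * n\<^sup>2) * (2 * n\<^sup>2)"
    using norm_b[of n] norm_b[of "- n"] by (simp add: power_mult_distrib n_def)
  moreover have "(norm (b * b + of_real (n * n)))\<^sup>2 + (norm (b * b - of_real (n * n)))\<^sup>2
      = 2 * (norm (b * b))\<^sup>2 + 2 * (n * n)\<^sup>2"
    using parallelogram[of "b * b" "of_real (n * n)"] by (simp only: norm_of_real power2_abs)
  ultimately have "(norm (b * b + of_real (n * n)))\<^sup>2 = 0"
    by (simp add: norm_mult n_def power2_eq_square)
  then have bb: "b * b = - of_real (n * n)" by (simp add: add_eq_0_iff2)
  have "(norm a)\<^sup>2 = n\<^sup>2 + t\<^sup>2" using norm_b[of t] by (simp add: b_def n_def)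
  then have "of_real ((norm a)\<^sup>2) = of_real (t * t) - b * b" by (simp add: bb power2_eq_square)
  \<comment> \<open>A difference of squares with \<open>a = b + of_real t\<close>. Dividing by
    \<open>a\<close> gives the conjugate; for \<open>a = 0\<close> both sides are 0.\<close>
  also have "\<dots> = a * (of_real (2 * t) - a)" by (simp add: b_def algebra_simps)
  finally show ?thesis
    unfolding t_def[symmetric] by (cases "a = 0") (auto simp: scalar_conj_def t_def)
qed

text \<open>By \<open>ip_commute\<close> this reduces to additivity of \<open>scalar_conj\<close>,
  visible from the formula in \<open>scalar_conj_eq\<close>. That formula needs a unit vector, so
  \<open>z = 0\<close> is separate.\<close>

lemma ip_add_right: "ip z (x + y) = ip z x + ip z y"
proof (cases "z = 0")
  case True
  then show ?thesis using ip_scale_left[of 0 0] by simp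
next
  case False
  define e where "e = sgn z"
  have e: "norm e = 1" using False by (simp add: e_def norm_sgn)
  have "scalar_conj (a + b) = scalar_conj a + scalar_conj b" for a b :: 'k
    by (simp add: scalar_conj_eq[OF e] scale_left_distrib inner_add_left algebra_simps)
  then show ?thesis by (simp only: ip_commute[of z] ip_add_left)
qed

text \<open>Polarization: both forms induce the same norm. This is the bridge between
  \<open>ip\<close> and \<open>inner\<close>.\<close>

lemma ip_add_ip_swap: "ip x y + ip y x = of_real (2 * inner x y)"
proof -
  have "of_real ((norm (x + y))\<^sup>2) = ip x x + ip y y + (ip x y + ip y x)"
    by (simp only: ip_self[symmetric] ip_add_left ip_add_right ac_simps)
  moreover have "(norm (x + y))\<^sup>2 = (norm x)\<^sup>2 + (norm y)\<^sup>2 + 2 * inner x y"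
    by (simp add: power2_norm_eq_inner inner_simps inner_commute)
  ultimately show ?thesis by (simp add: ip_self del: of_real_power)
qed

lemma real_projection_of_orthogonal_projection:
  assumes "orthogonal_projection smul ip P"
  shows "real_projection P"
proof (rule real_projectionI)
  show "P (P x) = P x" for x
    using assms unfolding orthogonal_projection_def by (metis blinfun_apply_blinfun_compose)
  have "ip (P x) y = ip x (P y)" for x y
    using assms unfolding orthogonal_projection_def by blast
  then have "(of_real (2 * inner (P x) y) :: 'k) = of_real (2 * inner x (P y))" for x y
    by (simp only: ip_add_ip_swap[symmetric])
  then show "inner (P x) y = inner x (P y)" for x y by (simp only: of_real_eq_iff) simp
qed

text \<open>Multiplying \<open>z\<close> by the conjugate of \<open>ip z u\<close> makes the product
  real, equal to the squared norm of \<open>ip z u\<close>; real orthogonality then makes it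
  vanish.\<close>

lemma ip_eq_0_of_inner_eq_0:
  assumes "\<And>z. z \<in> M \<Longrightarrow> inner u z = 0" and "\<And>c z. z \<in> M \<Longrightarrow> smul c z \<in> M" and "z \<in> M"
  shows "ip z u = 0"
proof -
  define c where "c = scalar_conj (ip z u)"
  have z: "ip (smul c z) u = of_real ((norm (ip z u))\<^sup>2)"
    by (simp only: ip_scale_left c_def scalar_conj_mult mult.commute[of "scalar_conj _"])
  then have "ip u (smul c z) = of_real ((norm (ip z u))\<^sup>2)"
    by (simp only: ip_commute[of u] scalar_conj_of_real)
  with z have "(of_real (2 * (norm (ip z u))\<^sup>2) :: 'k) = of_real (2 * inner u (smul c z))"
    by (simp only: ip_add_ip_swap[symmetric]) simp
  then have "2 * (norm (ip z u))\<^sup>2 = 2 * inner u (smul c z)" by (simp only: of_real_eq_iff)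
  then show ?thesis using assms by simp
qed

lemma ip_zero_left: "ip 0 x = 0"
  using ip_add_left[of 0 0 x] by simp

lemma ip_diff_left: "ip (x - y) z = ip x z - ip y z"
  using ip_add_left[of "x - y" y z] by simp

lemma ip_diff_right: "ip z (x - y) = ip z x - ip z y"
  using ip_add_right[of z "x - y" y] by simp

section \<open>Projections onto closed subspaces over the scalar field\<close>

text \<open>The real orthogonal decomposition defines \<open>f\<close>. Orthogonality to
  \<open>M\<close> upgrades from \<open>inner\<close> to \<open>ip\<close>, and uniqueness of the
  decomposition makes \<open>f\<close> linear over \<open>'k\<close>.\<close>

lemma orthogonal_projection_exists:
  assumes "closed M" and M: "subspace M"
  obtains P where "orthogonal_projection smul ip P" and "range P = M"
proof -
  have M': "Real_Vector_Spaces.subspace M"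
    using M by (auto simp: subspace_def Real_Vector_Spaces.subspace_def scale_of_real[symmetric])
  have "\<exists>y. y \<in> M \<and> (\<forall>z\<in>M. inner (x - y) z = 0)" for x
    using orthogonal_decomposition[OF assms(1) M', of x] by metis
  then obtain f where f: "\<And>x. f x \<in> M" and f_orth: "\<And>x z. z \<in> M \<Longrightarrow> inner (x - f x) z = 0"
    by metis
  have uniq: "f x = y" if "y \<in> M" "\<And>z. z \<in> M \<Longrightarrow> inner (x - y) z = 0" for x y
  proof -
    have "f x - y \<in> M" using M f that(1) by (rule subspace_diff)
    then have "inner (x - y) (f x - y) = 0" "inner (x - f x) (f x - y) = 0" using that(2) f_orth by auto
    then have "inner (f x - y) (f x - y) = 0" by (simp add: inner_diff_left inner_diff_right)
    then show ?thesis by simp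
  qed
  have orth: "ip z (x - f x) = 0" "ip (x - f x) z = 0" if "z \<in> M" for x z
  proof -
    show "ip z (x - f x) = 0"
      using f_orth subspace_scale[OF M] that by (rule ip_eq_0_of_inner_eq_0)
    then show "ip (x - f x) z = 0"
      using ip_commute[of "x - f x" z] scalar_conj_of_real[of 0] by simp
  qed
  have add: "f (x + y) = f x + f y" for x y
  proof (rule uniq)
    show "f x + f y \<in> M" using M f f by (rule subspace_add)
    show "inner (x + y - (f x + f y)) z = 0" if "z \<in> M" for z
      using f_orth[OF that, of x] f_orth[OF that, of y] by (simp add: inner_simps)
  qed
  have scale: "f (smul c x) = smul c (f x)" for c x
  proof (rule uniq)
    show "smul c (f x) \<in> M" using M f by (rule subspace_scale)
    fix z assume z: "z \<in> M"
    have "ip (smul c x - smul c (f x)) z = 0"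
      using orth(2)[OF z, of x] by (simp add: scale_right_diff_distrib[symmetric] ip_scale_left)
    moreover from this have "ip z (smul c x - smul c (f x)) = 0"
      using ip_commute[of z "smul c x - smul c (f x)"] scalar_conj_of_real[of 0] by simp
    ultimately show "inner (smul c x - smul c (f x)) z = 0"
      using ip_add_ip_swap[of "smul c x - smul c (f x)" z] by simp
  qed
  have "norm (f x) \<le> norm x * 1" for x
  proof -
    have "(norm (f x))\<^sup>2 = inner x (f x)"
      using f_orth[OF f[of x], of x] by (simp add: power2_norm_eq_inner inner_diff_left)
    also have "\<dots> \<le> norm x * norm (f x)" by (rule norm_cauchy_schwarz)
    finally show ?thesis by (cases "f x = 0") (auto simp: power2_eq_square)
  qed
  then have "bounded_linear f"
    using add scale by (intro bounded_linear_intro[of f 1]) (simp_all add: scale_of_real[symmetric])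
  then have P: "blinfun_apply (Blinfun f) = f" by (rule bounded_linear_Blinfun_apply)
  have fM: "f y = y" if "y \<in> M" for y using that by (intro uniq) auto
  have sym: "ip (f x) y = ip x (f y)" for x y
    using orth(1)[OF f[of x], of y] orth(2)[OF f[of y], of x] by (simp add: ip_diff_left ip_diff_right)
  have "orthogonal_projection smul ip (Blinfun f)"
    unfolding orthogonal_projection_def bounded_operators_def
    by (auto simp: P scale sym fM f intro!: blinfun_eqI)
  moreover have "range (Blinfun f) = M" 
    unfolding P using f by (auto intro: fM[symmetric])
  ultimately show thesis by (rule that)
qed

lemma proj_onto_range:
  assumes "orthogonal_projection smul ip P"
  shows "proj_onto smul ip (range P) = P"
  unfolding proj_onto_def
proof (rule the_equality)
  fix P' assume "orthogonal_projection smul ip P' \<and> range P' = range P"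
  then show "P' = P"
    using assms by (intro real_projection_unique real_projection_of_orthogonal_projection) auto
qed (use assms in simp)

lemma orthogonal_projection_complement:
  assumes "orthogonal_projection smul ip P"
  shows "orthogonal_projection smul ip (id_blinfun - P)"
  using assms real_projection_idem[OF real_projection_of_orthogonal_projection[OF assms]]
  unfolding orthogonal_projection_def bounded_operators_def
  by (auto simp: blinfun.diff_left blinfun.diff_right scale_right_diff_distrib ip_diff_left ip_diff_right
      intro!: blinfun_eqI)

lemma ortho_compl_range:
  assumes "orthogonal_projection smul ip P"
  shows "ortho_compl ip (range P) = nullspace P"
proof -
  have sym: "ip (P x) y = ip x (P y)" for x y
    using assms unfolding orthogonal_projection_def by blast
  have "P x = 0" if "\<And>y. ip x (P y) = 0" for x
    using that[of "P x"] ip_self[of "P x"] sym[of x "P x"] by simp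
  moreover have "ip x (P y) = 0" if "P x = 0" for x y
    using that by (simp add: sym[symmetric] ip_zero_left)
  ultimately show ?thesis unfolding ortho_compl_def nullspace_def by blast
qed

lemma nullspace_eq_range_complement:
  assumes "real_projection P"
  shows "nullspace P = range (id_blinfun - P)"
proof -
  have "x \<in> range (id_blinfun - P)" if "P x = 0" for x
    using that by (intro image_eqI[of _ _ x]) (simp_all add: blinfun.diff_left)
  then show ?thesis
    using real_projection_idem[OF assms] by (auto simp: nullspace_def blinfun.diff_left blinfun.diff_right)
qed

text \<open>\<open>nullspace Q\<close> is the range of the complementary projection, whose
  orthogonal complement is the nullspace of that projection, namely \<open>range Q\<close>.\<close>

lemma proj_onto_ortho_compl_nullspace:
  assumes "orthogonal_projection smul ip Q"
  shows "proj_onto smul ip (ortho_compl ip (nullspace Q)) = Q"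
proof -
  note Q' = orthogonal_projection_complement[OF assms]
  have "ortho_compl ip (nullspace Q) = range Q"
    using ortho_compl_range[OF Q'] assms Q'
    by (simp add: nullspace_eq_range_complement real_projection_of_orthogonal_projection)
  then show ?thesis using proj_onto_range[OF assms] by simp
qed

section \<open>Recovering the canonical factors from the product\<close>

lemma factorization_of_norm_diff_less_1:
  assumes P: "orthogonal_projection smul ip P" and Q: "orthogonal_projection smul ip Q"
    and "norm (P - Q) < 1"
  shows "closed (range (P o\<^sub>L Q))"
    and "proj_onto smul ip (range (P o\<^sub>L Q)) = P"
    and "proj_onto smul ip (ortho_compl ip (nullspace (P o\<^sub>L Q))) = Q"
proof -
  note rP = real_projection_of_orthogonal_projection[OF P]
  note eq = range_nullspace_of_norm_diff_less_1[OF rP real_projection_of_orthogonal_projection[OF Q] assms(3)]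
  show "closed (range (P o\<^sub>L Q))"
    using closed_range_real_projection[OF rP] by (simp only: eq)
  show "proj_onto smul ip (range (P o\<^sub>L Q)) = P"
    using proj_onto_range[OF P] by (simp only: eq)
  show "proj_onto smul ip (ortho_compl ip (nullspace (P o\<^sub>L Q))) = Q"
    using proj_onto_ortho_compl_nullspace[OF Q] by (simp only: eq)
qed

text \<open>Projections \<open>P\<close> and \<open>Q\<close> built from \<open>range T\<close> and
  \<open>nullspace T\<close> satisfy \<open>P P0 = P\<close> and \<open>Q0 Q = Q\<close>, hence
  \<open>P Q = T\<close>, and the strict real estimate applies to them.\<close>

lemma norm_diff_canonical_projections_less_1:
  assumes P0: "orthogonal_projection smul ip P0" and Q0: "orthogonal_projection smul ip Q0"
    and T: "T = P0 o\<^sub>L Q0" and closed: "closed (range T)"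
  shows "norm (proj_onto smul ip (range T) - proj_onto smul ip (ortho_compl ip (nullspace T))) < 1"
proof -
  have T_scale: "T (smul c x) = smul c (T x)" for c x
    using P0 Q0 by (simp add: T orthogonal_projection_def bounded_operators_def)
  have "subspace (range T)"
  proof (rule subspaceI)
    show "0 \<in> range T" by (metis blinfun.zero_right rangeI)
    show "x + y \<in> range T" if "x \<in> range T" "y \<in> range T" for x y
      using that by (metis (no_types, lifting) blinfun.add_right rangeE rangeI)
    show "smul c x \<in> range T" if "x \<in> range T" for c x
      using that by (metis (no_types, lifting) T_scale rangeE rangeI)
  qed
  then obtain P where P: "orthogonal_projection smul ip P" and range_P: "range P = range T"
    using closed orthogonal_projection_exists by blast
  have "subspace (nullspace T)"
    by (rule subspaceI) (auto simp: nullspace_def blinfun.add_right blinfun.zero_right T_scale)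
  moreover have "closed (nullspace T)"
    unfolding nullspace_def by (intro closed_Collect_eq continuous_intros)
  ultimately obtain N where N: "orthogonal_projection smul ip N" and range_N: "range N = nullspace T"
    using orthogonal_projection_exists by blast
  define Q where "Q = id_blinfun - N"
  have Q: "orthogonal_projection smul ip Q"
    unfolding Q_def using N by (rule orthogonal_projection_complement)
  note real = real_projection_of_orthogonal_projection
  have null_Q: "nullspace Q = nullspace T"
    using nullspace_eq_range_complement[OF real[OF Q]] range_N by (simp add: Q_def)
  have T_Q: "T (Q x) = T x" for x
  proof -
    have "N x \<in> nullspace T" using range_N by blast
    then show ?thesis by (simp add: Q_def nullspace_def blinfun.diff_left blinfun.diff_right)
  qed
  \<comment> \<open>\<open>Q x\<close> is orthogonal to \<open>nullspace T\<close>, which contains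
    \<open>Q x - Q0 (Q x)\<close>. The inner product of these two vectors is the squared norm of the
    latter.\<close>
  have Q0_Q: "Q0 (Q x) = Q x" for x
  proof -
    have "Q x \<in> ortho_compl ip (nullspace T)"
      unfolding ortho_compl_range[OF N, unfolded range_N]
      by (simp add: nullspace_def Q_def blinfun.diff_left blinfun.diff_right real_projection_idem[OF real[OF N]])
    moreover have "Q x - Q0 (Q x) \<in> nullspace T"
      by (simp add: nullspace_def T blinfun.diff_right real_projection_idem[OF real[OF Q0]])
    ultimately have "ip (Q x) (Q x - Q0 (Q x)) = 0" by (simp add: ortho_compl_def)
    then have "inner (Q x) (Q x - Q0 (Q x)) = 0"
      using ip_add_ip_swap[of "Q x" "Q x - Q0 (Q x)"] ip_commute[of "Q x - Q0 (Q x)" "Q x"]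
      by (simp add: scalar_conj_def)
    then have "norm (Q x - Q0 (Q x)) = 0"
      using real_projection_sym[OF real[OF Q0], of "Q x" "Q x - Q0 (Q x)"]
      by (simp add: norm_eq_sqrt_inner inner_diff_left blinfun.diff_right real_projection_idem[OF real[OF Q0]])
    then show ?thesis by simp
  qed
  \<comment> \<open>The range of \<open>P\<close> is \<open>range T\<close>, inside
    \<open>range P0\<close>, so \<open>P0 P = P\<close>; taking adjoints gives the claim.\<close>
  have P_P0: "P (P0 x) = P x" for x
  proof -
    have "P0 (P y) = P y" for y
    proof -
      have "P y \<in> range T" using range_P by blast
      then show ?thesis by (auto simp: T real_projection_idem[OF real[OF P0]])
    qed
    then have "inner (P (P0 x)) y = inner (P x) y" for y
      using real_projection_sym[OF real[OF P], of "P0 x" y] real_projection_sym[OF real[OF P], of x y]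
        real_projection_sym[OF real[OF P0], of x "P y"] by simp
    then show ?thesis using vector_eq_rdot by blast
  qed
  have P_T: "P (T x) = T x" for x
  proof -
    have "T x \<in> range P" unfolding range_P by (rule rangeI)
    then show ?thesis by (auto simp: real_projection_idem[OF real[OF P]])
  qed
  \<comment> \<open>Crimmins' factorization\<close>
  have T_eq: "P o\<^sub>L Q = T"
  proof (rule blinfun_eqI)
    fix x
    have "T x = P (P0 (Q0 (Q x)))" using P_T[of "Q x"] T_Q[of x] by (simp add: T)
    then show "(P o\<^sub>L Q) x = T x" by (simp add: Q0_Q P_P0)
  qed
  have "norm (P - Q) < 1"
    using real[OF P] real[OF Q]
    by (rule norm_diff_less_1_of_range_nullspace) (simp_all only: T_eq range_P null_Q)
  \<comment> \<open>The strict bound itself identifies \<open>P\<close> and \<open>Q\<close> with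
    the two \<open>proj_onto\<close> terms.\<close>
  then show ?thesis
    using factorization_of_norm_diff_less_1[OF P Q] by (simp add: T_eq)
qed

end

theorem theorem3p10:
  fixes smul :: "'k::real_normed_field \<Rightarrow> 'h::{real_inner,complete_space} \<Rightarrow> 'h"
    and ip :: "'h \<Rightarrow> 'h \<Rightarrow> 'k"
    and T :: "'h \<Rightarrow>\<^sub>L 'h"
  assumes "hilbert_space smul ip"
    and "T \<in> bounded_operators smul"
    and "\<exists>P Q. orthogonal_projection smul ip P \<and> orthogonal_projection smul ip Q \<and> T = P o\<^sub>L Q"
  shows "(\<not> closed (range (blinfun_apply T)) \<longrightarrow>
           (\<forall>(P, Q) \<in> proj_factorizations smul ip T. norm (P - Q) = 1)) \<and>
         (closed (range (blinfun_apply T)) \<longrightarrow>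
           norm (proj_onto smul ip (range (blinfun_apply T))
                 - proj_onto smul ip (ortho_compl ip (nullspace T))) < 1 \<and>
           (\<forall>(P, Q) \<in> proj_factorizations smul ip T.
              (P, Q) \<noteq> (proj_onto smul ip (range (blinfun_apply T)),
                        proj_onto smul ip (ortho_compl ip (nullspace T)))
              \<longrightarrow> norm (P - Q) = 1))"
proof -
  interpret hilbert_space smul ip by fact
  \<comment> \<open>A pair whose norm is not 1 has norm below 1, which forces both a closed range
    and the canonical factors. Both halves of the theorem use this contrapositively.\<close>
  have dichotomy: "norm (P - Q) = 1 \<or> closed (range T) \<and> P = proj_onto smul ip (range T)
      \<and> Q = proj_onto smul ip (ortho_compl ip (nullspace T))"
    if "(P, Q) \<in> proj_factorizations smul ip T" for P Q
  proof -
    have P: "orthogonal_projection smul ip P" and Q: "orthogonal_projection smul ip Q"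
      and T: "T = P o\<^sub>L Q"
      using that by (auto simp: proj_factorizations_def)
    have "norm (P - Q) \<le> 1"
      using P Q by (intro norm_diff_real_projections_le_1 real_projection_of_orthogonal_projection)
    then consider "norm (P - Q) = 1" | "norm (P - Q) < 1" by linarith
    then show ?thesis
      using factorization_of_norm_diff_less_1[OF P Q] unfolding T by cases auto
  qed
  obtain P0 Q0 where "orthogonal_projection smul ip P0" "orthogonal_projection smul ip Q0" "T = P0 o\<^sub>L Q0"
    using assms(3) by blast
  note less = norm_diff_canonical_projections_less_1[OF this]
  show ?thesis
  proof (intro conjI impI ballI)
    fix x
    assume "x \<in> proj_factorizations smul ip T" and "\<not> closed (range T)"
    then show "case x of (P, Q) \<Rightarrow> norm (P - Q) = 1"
      using dichotomy[of "fst x" "snd x"] by (simp add: case_prod_beta)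
  next
    fix x
    assume "x \<in> proj_factorizations smul ip T"
    then show "case x of (P, Q) \<Rightarrow>
        (P, Q) \<noteq> (proj_onto smul ip (range T), proj_onto smul ip (ortho_compl ip (nullspace T)))
        \<longrightarrow> norm (P - Q) = 1"
      using dichotomy[of "fst x" "snd x"] by (auto simp: case_prod_beta)
  qed (rule less)
qed

end
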